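(* Let $\mathbf{M}=\{M^{(1)},\dots,M^{(k)}\}$ be a set of real $2\times2$ matrices $M^{(j)}=\begin{bmatrix}a_j&b_j\\c_j&d_j\end{bmatrix}$ such that $0<\det(M^{(j)})<\frac14\mathrm{trace}(M^{(j)})^2$ and $b_j\ne0$ for each $j\in\{1,\dots,k\}$. Let $m^{(j)}_{\rm stab}$, $m^{(j)}_{\rm unstab}$, $J$, $C_J$ and $H_j$ be as defined in the context. If $$m^{(j)}_{\rm unstab}\notin J\quad\text{for each }j\in\{1,\dots,k\},$$ then $C_J$ is invariant under $\mathbf{M}$. If also $$H_j(m)>0\quad\text{for each }j\in\{1,\dots,k\}\text{ and all }m\in J,$$ then $C_J$ is expanding under $\mathbf{M}$.
   Context: For each $j$ let $G_j(m)=\frac{c_j+d_jm}{a_j+b_jm}$ (the slope of $M^{(j)}(1,m)^{\sf T}$) and $H_j(m)=(b_j^2+d_j^2-1)m^2+2(a_jb_j+c_jd_j)m+a_j^2+c_j^2-1$. Under the stated assumptions on $M^{(j)}$, $G_j$ has exactly two fixed points: $m^{(j)}_{\rm stab}$, at which $0<\frac{dG_j}{dm}<1$, and $m^{(j)}_{\rm unstab}$, at which $\frac{dG_j}{dm}>1$. Let $m_{\rm stab,min}$ and $m_{\rm stab,max}$ be the minimum and maximum of $\{m^{(1)}_{\rm stab},\dots,m^{(k)}_{\rm stab}\}$, let $J=[m_{\rm stab,min},m_{\rm stab,max}]$, and let $C_J=\{t(1,m)\mid t\in\mathbb{R},\,m\in J\}\subset\mathbb{R}^2$. A cone $C$ (a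 nonempty set closed under multiplication by all real scalars) is invariant under $\mathbf{M}$ if $Mv\in C$ for all $v\in C$, $M\in\mathbf{M}$; it is expanding under $\mathbf{M}$ if for every $M\in\mathbf{M}$ there exists $c>1$ with $\|Mv\|\ge c\|v\|$ for all $v\in C$, where $\|\cdot\|$ is the Euclidean norm. *)

theory Defs
  imports "HOL-Analysis.Analysis"
begin

definition slope_map :: "real^2^2 \<Rightarrow> real \<Rightarrow> real" where
  "slope_map A m = (A$2$1 + A$2$2 * m) / (A$1$1 + A$1$2 * m)"

text \<open>At a pole, where the image of \<open>(1, m)\<close> is vertical and has no slope, HOL evaluates
  \<open>slope_map A m\<close> to \<open>0\<close>; without the condition on the denominator the pole \<open>m = 0\<close> of a matrix
  with \<open>A$1$1 = 0\<close> would be a spurious fixed point.\<close>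

definition slope_fixed_point :: "real^2^2 \<Rightarrow> real \<Rightarrow> bool" where
  "slope_fixed_point A m \<longleftrightarrow> A$1$1 + A$1$2 * m \<noteq> 0 \<and> slope_map A m = m"

text \<open>Existence and uniqueness in the next two definitions hold for
  \<open>0 < det A < (trace A)\<^sup>2 / 4\<close> and \<open>A$1$2 \<noteq> 0\<close>.\<close>

definition m_stab :: "real^2^2 \<Rightarrow> real" where
  "m_stab A = (THE m. slope_fixed_point A m \<and> 0 < deriv (slope_map A) m \<and> deriv (slope_map A) m < 1)"

definition m_unstab :: "real^2^2 \<Rightarrow> real" where
  "m_unstab A = (THE m. slope_fixed_point A m \<and> 1 < deriv (slope_map A) m)"

definition stab_interval :: "(real^2^2) set \<Rightarrow> real set" where
  "stab_interval S = {Min (m_stab ` S)..Max (m_stab ` S)}"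

definition slope_cone :: "real set \<Rightarrow> (real^2) set" where
  "slope_cone J = {t *\<^sub>R vector [1, m] | t m. m \<in> J}"

definition H_poly :: "real^2^2 \<Rightarrow> real \<Rightarrow> real" where
  "H_poly A m = ((A$1$2)\<^sup>2 + (A$2$2)\<^sup>2 - 1) * m\<^sup>2
     + 2 * (A$1$1 * A$1$2 + A$2$1 * A$2$2) * m + (A$1$1)\<^sup>2 + (A$2$1)\<^sup>2 - 1"

text \<open>Closed under all real scalars, unlike the library's \<^const>\<open>cone\<close>, which only asks for
  nonnegative ones.\<close>

definition double_cone :: "(real^2) set \<Rightarrow> bool" where
  "double_cone C \<longleftrightarrow> C \<noteq> {} \<and> (\<forall>v\<in>C. \<forall>t::real. t *\<^sub>R v \<in> C)"

definition invariant_cone :: "(real^2^2) set \<Rightarrow> (real^2) set \<Rightarrow> bool" where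
  "invariant_cone S C \<longleftrightarrow> double_cone C \<and> (\<forall>A\<in>S. \<forall>v\<in>C. A *v v \<in> C)"

definition expanding_cone :: "(real^2^2) set \<Rightarrow> (real^2) set \<Rightarrow> bool" where
  "expanding_cone S C \<longleftrightarrow>
     double_cone C \<and> (\<forall>A\<in>S. \<exists>c>1. \<forall>v\<in>C. norm (A *v v) \<ge> c * norm v)"

end

theory Submission
  imports Defs
begin

text \<open>In the coordinate \<open>x = a + b m\<close> the fixed points of the slope map \<open>G\<close> are the two eigenvalues
  \<open>\<lambda>\<close> and \<open>r \<lambda>\<close> with \<open>0 < r < 1\<close>, at which \<open>G' = r\<close> and \<open>G' = 1 / r\<close>. As
  \<open>G m - m_stab = (r \<lambda> / x) (m - m_stab)\<close>, and \<open>0 < r \<lambda> / x < 1\<close> whenever \<open>m\<close> is on the same side of the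
  unstable fixed point as the stable one, \<open>G\<close> moves each \<open>m \<in> J\<close> towards \<open>m_stab \<in> J\<close>, hence
  preserves \<open>J\<close>. Expansion follows from compactness of \<open>J\<close>, because \<open>H m\<close> is the growth of the squared
  norm of \<open>(1, m)\<close>.\<close>

text \<open>For \<open>D\<close> a determinant and \<open>T\<close> a trace, the positive
  discriminant makes the eigenvalues real and distinct, and their positive product gives them one
  sign. \<open>l\<close> is the one of larger modulus and \<open>r\<close> is their ratio.\<close>

lemma real_eigenvalues_same_sign:
  fixes D T :: real
  assumes "0 < D" "D < 1/4 * T\<^sup>2"
  obtains (eigenvalues) l r
    where "l \<noteq> 0" "0 < r" "r < 1" "D = r * l\<^sup>2" "T = (1 + r) * l"
proof -
  define s where "s = sqrt (T\<^sup>2 - 4 * D)"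
  have s: "s > 0" "s\<^sup>2 = T\<^sup>2 - 4 * D" using assms by (auto simp: s_def)
  have T0: "T \<noteq> 0" using assms by auto
  \<comment> \<open>\<open>u\<close> stands for the sign of \<open>T\<close>: adding
    \<open>u * s\<close> to \<open>T\<close> selects the root of larger modulus for both signs at
    once.\<close>
  have gen: thesis if u: "u * u = 1" "T * u > 0" for u
  proof -
    define l where "l = (T + u * s) / 2"
    define n where "n = (T - u * s) / 2"
    have u2: "u\<^sup>2 = 1" using u by (simp add: power2_eq_square)
    have "l * n = (T\<^sup>2 - u\<^sup>2 * s\<^sup>2) / 4" by (simp add: l_def n_def field_simps power2_eq_square)
    then have ln: "l * n = D" "l + n = T"
      using s u2 by (simp, simp add: l_def n_def field_simps)
    have lu: "l * u = (T * u + s) / 2"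
      using u by (simp add: l_def field_simps)
    then have lu0: "l * u > 0" using s u by simp
    then have l0: "l \<noteq> 0" by auto
    \<comment> \<open>Positivity of this product says \<open>l * n < l\<^sup>2\<close>, which puts
      the ratio \<open>n / l\<close> below 1.\<close>
    have "(l - n) * l = s * (u * l)" by (simp add: l_def n_def field_simps)
    also have "\<dots> > 0" using s lu0 by (simp add: mult.commute)
    finally have "D < l\<^sup>2" using ln by (simp add: algebra_simps power2_eq_square)
    moreover have "n / l = D / l\<^sup>2" using l0 ln by (auto simp: power2_eq_square)
    ultimately have "0 < n / l" "n / l < 1" using assms(1) l0 by auto
    then show thesis
      using eigenvalues[of l "n / l"] l0 ln by (simp add: field_simps power2_eq_square)
  qed
  show thesis
    using gen[of "sgn T"] T0 by (cases "T > 0") (auto simp: sgn_if)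
qed

lemma deriv_slope_map:
  assumes "A$1$1 + A$1$2 * m \<noteq> 0"
  shows "deriv (slope_map A) m = det A / (A$1$1 + A$1$2 * m)\<^sup>2"
proof -
  have "((\<lambda>m. (A$2$1 + A$2$2 * m) / (A$1$1 + A$1$2 * m)) has_field_derivative
      (A$2$2 * (A$1$1 + A$1$2 * m) - (A$2$1 + A$2$2 * m) * A$1$2)
        / ((A$1$1 + A$1$2 * m) * (A$1$1 + A$1$2 * m))) (at m)"
    using assms by (intro DERIV_divide) (auto intro!: derivative_eq_intros)
  also have "A$2$2 * (A$1$1 + A$1$2 * m) - (A$2$1 + A$2$2 * m) * A$1$2 = det A"
    by (simp add: det_2 algebra_simps)
  also have "(A$1$1 + A$1$2 * m) * (A$1$1 + A$1$2 * m) = (A$1$1 + A$1$2 * m)\<^sup>2"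
    by (simp add: power2_eq_square)
  finally show ?thesis
    unfolding slope_map_def by (rule DERIV_imp_deriv)
qed

text \<open>At a fixed slope, \<open>(1, m)\<close> is an eigenvector whose eigenvalue is the first
  component of its image. The derivative is the determinant over the square of that eigenvalue, so
  it tells the two fixed points apart and makes both descriptions by \<open>THE\<close>
  unique.\<close>

lemma m_stab_m_unstab_eigenvalues:
  assumes "0 < det A" "det A < 1/4 * (trace A)\<^sup>2" and b: "A$1$2 \<noteq> 0"
  obtains l r where "l \<noteq> 0" "0 < r" "r < 1" "det A = r * l\<^sup>2" "trace A = (1 + r) * l"
    "A$1$1 + A$1$2 * m_stab A = l" "A$1$1 + A$1$2 * m_unstab A = r * l"
proof -
  obtain l r where lr: "l \<noteq> 0" "0 < r" "r < 1" "det A = r * l\<^sup>2" "trace A = (1 + r) * l"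
    using real_eigenvalues_same_sign[OF assms(1,2)] .
  have fixed_iff: "slope_fixed_point A m \<longleftrightarrow> A$1$1 + A$1$2 * m = l \<or> A$1$1 + A$1$2 * m = r * l"
    for m
  proof -
    define x where "x = A$1$1 + A$1$2 * m"
    \<comment> \<open>The factor \<open>A$1$2\<close> allows the substitutions
      \<open>A$1$2 * m = x - A$1$1\<close> and, through the determinant, that of
      \<open>A$1$2 * A$2$1\<close>; what remains is minus the characteristic polynomial at
      \<open>x\<close>.\<close>
    have "A$1$2 * (A$2$1 + A$2$2 * m - m * x) = - ((x - l) * (x - r * l))"
    proof -
      have d: "A$2$2 = (1 + r) * l - A$1$1" using lr(5) by (simp add: trace_def sum_2)
      have c: "A$1$2 * A$2$1 = A$1$1 * A$2$2 - r * l\<^sup>2" using lr(4) by (simp add: det_2)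
      have "A$1$2 * (A$2$1 + A$2$2 * m - m * x)
          = A$1$2 * A$2$1 + A$2$2 * (x - A$1$1) - (x - A$1$1) * x"
        by (simp add: x_def algebra_simps)
      then show ?thesis
        unfolding c d by (simp add: algebra_simps power2_eq_square)
    qed
    then have *: "A$2$1 + A$2$2 * m = m * x \<longleftrightarrow> x = l \<or> x = r * l"
      using b by (metis eq_iff_diff_eq_0 mult_eq_0_iff neg_equal_0_iff_equal)
    have "slope_fixed_point A m \<longleftrightarrow> x \<noteq> 0 \<and> A$2$1 + A$2$2 * m = m * x"
      unfolding slope_fixed_point_def slope_map_def x_def[symmetric] by (auto simp: divide_eq_eq)
    then show ?thesis
      using * lr by (auto simp: x_def)
  qed
  have d_stab: "deriv (slope_map A) m = r" if "A$1$1 + A$1$2 * m = l" for m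
    using deriv_slope_map[of A m] that lr by simp
  have d_unstab: "deriv (slope_map A) m = 1 / r" if "A$1$1 + A$1$2 * m = r * l" for m
    using deriv_slope_map[of A m] lr unfolding that by (simp add: power2_eq_square)
  have r: "1 < 1 / r" using lr by simp
  have "m_stab A = (l - A$1$1) / A$1$2"
    unfolding m_stab_def
  proof (rule the_equality)
    show "slope_fixed_point A ((l - A$1$1) / A$1$2) \<and> 0 < deriv (slope_map A) ((l - A$1$1) / A$1$2)
      \<and> deriv (slope_map A) ((l - A$1$1) / A$1$2) < 1"
      using b lr d_stab by (simp add: fixed_iff)
  next
    fix m
    assume "slope_fixed_point A m \<and> 0 < deriv (slope_map A) m \<and> deriv (slope_map A) m < 1"
    then have "A$1$1 + A$1$2 * m = l"
      using d_unstab[of m] r unfolding fixed_iff by force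
    then show "m = (l - A$1$1) / A$1$2" using b by (auto simp: field_simps)
  qed
  moreover have "m_unstab A = (r * l - A$1$1) / A$1$2"
    unfolding m_unstab_def
  proof (rule the_equality)
    show "slope_fixed_point A ((r * l - A$1$1) / A$1$2)
      \<and> 1 < deriv (slope_map A) ((r * l - A$1$1) / A$1$2)"
      using b r d_unstab[of "(r * l - A$1$1) / A$1$2"] by (simp add: fixed_iff)
  next
    fix m
    assume "slope_fixed_point A m \<and> 1 < deriv (slope_map A) m"
    then have "A$1$1 + A$1$2 * m = r * l"
      using d_stab[of m] lr(3) unfolding fixed_iff by force
    then show "m = (r * l - A$1$1) / A$1$2" using b by (auto simp: field_simps)
  qed
  ultimately show thesis
    using that[OF lr] b by simp
qed

text \<open>On the stable side of the unstable fixed point, the denominator has the sign of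
  \<open>l\<close> and modulus above that of \<open>r * l\<close>. It is therefore nonzero, and the
  image is a convex combination of \<open>m_stab A\<close> and \<open>m\<close>.\<close>

lemma slope_map_in_closed_segment:
  assumes "0 < det A" "det A < 1/4 * (trace A)\<^sup>2" and b: "A$1$2 \<noteq> 0"
    and side: "(m - m_unstab A) * (m_stab A - m_unstab A) > 0"
  shows "A$1$1 + A$1$2 * m \<noteq> 0" "slope_map A m \<in> closed_segment (m_stab A) m"
proof -
  obtain l r where lr: "l \<noteq> 0" "0 < r" "r < 1" "det A = r * l\<^sup>2" "trace A = (1 + r) * l"
    and p: "A$1$1 + A$1$2 * m_stab A = l" and q: "A$1$1 + A$1$2 * m_unstab A = r * l"
    using m_stab_m_unstab_eigenvalues[OF assms(1-3)] .
  define x where "x = A$1$1 + A$1$2 * m"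
  \<comment> \<open>The square carries the sign condition over to the coordinate \<open>x\<close>,
    whatever the sign of \<open>A$1$2\<close>.\<close>
  have "0 < (A$1$2)\<^sup>2 * ((m - m_unstab A) * (m_stab A - m_unstab A))"
    using b side by (intro mult_pos_pos[OF _ side]) simp
  also have "\<dots> = (A$1$2 * m - A$1$2 * m_unstab A) * (A$1$2 * m_stab A - A$1$2 * m_unstab A)"
    by (simp add: algebra_simps power2_eq_square)
  also have "\<dots> = (x - r * l) * (l - r * l)"
    using p q unfolding x_def by (metis add_diff_cancel_left)
  also have "\<dots> = (1 - r) * (x * l - r * l\<^sup>2)"
    by (simp add: algebra_simps power2_eq_square)
  finally have "x * l > r * l\<^sup>2"
    using lr by (simp add: zero_less_mult_iff)
  moreover have rl: "r * l\<^sup>2 > 0" using lr by simp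
  ultimately have xl: "x * l > r * l\<^sup>2" "x * l > 0" by auto
  then have x: "x \<noteq> 0" by auto
  then show "A$1$1 + A$1$2 * m \<noteq> 0" by (simp add: x_def)
  define t where "t = r * l / x"
  \<comment> \<open>Extending the fraction by \<open>l\<close> makes numerator and denominator
    positive, so no cases on the sign of \<open>l\<close> arise.\<close>
  have "t = r * l\<^sup>2 / (x * l)" using lr x by (simp add: t_def power2_eq_square)
  then have t: "0 \<le> t" "t \<le> 1" using xl rl by auto
  have d: "A$2$2 = (1 + r) * l - A$1$1" using lr(5) by (simp add: trace_def sum_2)
  have c: "A$1$2 * A$2$1 = A$1$1 * A$2$2 - r * l\<^sup>2" using lr(4) by (simp add: det_2)
  have "A$1$2 * (A$2$1 + A$2$2 * m) = A$1$2 * A$2$1 + A$2$2 * (x - A$1$1)"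
    by (simp add: x_def algebra_simps)
  also have "\<dots> = (l - A$1$1) * x + r * l * (x - l)"
    unfolding c d by (simp add: algebra_simps power2_eq_square)
  also have "\<dots> = A$1$2 * (m_stab A * x + r * l * (m - m_stab A))"
    unfolding p[symmetric] by (simp add: x_def algebra_simps)
  finally have "A$2$1 + A$2$2 * m = m_stab A * x + r * l * (m - m_stab A)"
    using b by simp
  then have "slope_map A m = (1 - t) * m_stab A + t * m"
    using x unfolding slope_map_def x_def[symmetric] t_def by (simp add: field_simps)
  then show "slope_map A m \<in> closed_segment (m_stab A) m"
    using t unfolding in_segment by auto
qed

text \<open>Otherwise \<open>q\<close> would lie between two points of \<open>J\<close>. This turns
  the absence of the unstable fixed point from \<open>J\<close> into the sign condition
  above.\<close>

lemma interval_same_side: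
  fixes p q m :: real
  assumes "is_interval J" "p \<in> J" "m \<in> J" "q \<notin> J"
  shows "(m - q) * (p - q) > 0"
proof (rule ccontr)
  assume "\<not> ?thesis"
  then have "m \<le> q \<and> q \<le> p \<or> p \<le> q \<and> q \<le> m"
    by (auto simp: zero_less_mult_iff)
  then show False
    using assms unfolding is_interval_1 by blast
qed

lemma mult_vector_slope:
  fixes A :: "real^2^2"
  shows "A *v vector [1, m] = vector [A$1$1 + A$1$2 * m, A$2$1 + A$2$2 * m]"
  by (simp add: vec_eq_iff forall_2 matrix_vector_mult_def sum_2)

lemma norm_vector2_squared: "(norm (vector [x, y] :: real^2))\<^sup>2 = x\<^sup>2 + y\<^sup>2"
  by (simp add: norm_vec_def L2_set_def sum_2)

lemma H_poly_eq_norm_growth: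
  "H_poly A m = (norm (A *v vector [1, m]))\<^sup>2 - (norm (vector [1, m] :: real^2))\<^sup>2"
  unfolding mult_vector_slope norm_vector2_squared H_poly_def
  by (simp add: algebra_simps power2_eq_square)

lemma double_cone_slope_cone:
  assumes "J \<noteq> {}"
  shows "double_cone (slope_cone J)"
  using assms unfolding double_cone_def slope_cone_def by (fastforce simp: scaleR_scaleR)

text \<open>The nonzero denominator excludes the default value at a pole, so
  \<open>slope_map A m\<close> is the true slope of the image.\<close>

lemma slope_cone_image:
  assumes "v \<in> slope_cone J" "\<And>m. m \<in> J \<Longrightarrow> A$1$1 + A$1$2 * m \<noteq> 0"
    "\<And>m. m \<in> J \<Longrightarrow> slope_map A m \<in> J"
  shows "A *v v \<in> slope_cone J"
proof -
  obtain t m where v: "v = t *\<^sub>R vector [1, m]" and m: "m \<in> J"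
    using assms(1) unfolding slope_cone_def by auto
  have "A *v v = (t * (A$1$1 + A$1$2 * m)) *\<^sub>R vector [1, slope_map A m]"
    unfolding v using assms(2)[OF m]
    by (simp add: matrix_vector_mult_scaleR mult_vector_slope vec_eq_iff forall_2 slope_map_def)
  then show ?thesis
    using assms(3)[OF m] unfolding slope_cone_def by blast
qed

lemma slope_cone_expansion:
  fixes A :: "real^2^2"
  assumes "compact J" "J \<noteq> {}" and H: "\<And>m. m \<in> J \<Longrightarrow> H_poly A m > 0"
  shows "\<exists>c>1. \<forall>v\<in>slope_cone J. norm (A *v v) \<ge> c * norm v"
proof -
  \<comment> \<open>\<open>f m\<close> is the squared stretching factor along slope
    \<open>m\<close>, the same for all multiples of \<open>(1, m)\<close>. The root of its minimum
    over \<open>J\<close> serves as the expansion constant.\<close>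
  define f where "f m = 1 + H_poly A m / (1 + m\<^sup>2)" for m
  have pos: "1 + m\<^sup>2 > 0" for m :: real
    by (simp add: add_pos_nonneg)
  have "continuous_on J f"
    unfolding f_def H_poly_def
    using pos by (intro continuous_intros) (auto simp: less_imp_neq[symmetric])
  then obtain m0 where m0: "m0 \<in> J" "\<And>m. m \<in> J \<Longrightarrow> f m0 \<le> f m"
    using continuous_attains_inf[OF assms(1,2)] by blast
  have f0: "f m0 > 1" using H[OF m0(1)] pos by (simp add: f_def)
  show ?thesis
  proof (intro exI[of _ "sqrt (f m0)"] conjI ballI)
    show "1 < sqrt (f m0)" using f0 by simp
    fix v assume "v \<in> slope_cone J"
    then obtain t m where v: "v = t *\<^sub>R vector [1, m]" and m: "m \<in> J"
      unfolding slope_cone_def by auto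
    let ?u = "vector [1, m] :: real^2"
    have u: "(norm ?u)\<^sup>2 = 1 + m\<^sup>2" by (simp add: norm_vector2_squared)
    have "(sqrt (f m0) * norm ?u)\<^sup>2 = f m0 * (1 + m\<^sup>2)"
      using f0 u by (simp add: power_mult_distrib)
    also have "\<dots> \<le> f m * (1 + m\<^sup>2)"
      using m0(2)[OF m] by (intro mult_right_mono) auto
    also have "\<dots> = (1 + m\<^sup>2) + H_poly A m"
      using pos[of m] by (simp add: f_def field_simps)
    also have "\<dots> = (norm (A *v ?u))\<^sup>2"
      using u by (simp add: H_poly_eq_norm_growth)
    finally have "sqrt (f m0) * norm ?u \<le> norm (A *v ?u)"
      by (rule power2_le_imp_le) simp
    then have "\<bar>t\<bar> * (sqrt (f m0) * norm ?u) \<le> \<bar>t\<bar> * norm (A *v ?u)"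
      by (rule mult_left_mono) simp
    then show "sqrt (f m0) * norm v \<le> norm (A *v v)"
      by (simp add: v matrix_vector_mult_scaleR mult.left_commute)
  qed
qed

theorem proposition5p2:
  fixes k :: nat and M :: "nat \<Rightarrow> real^2^2" and J :: "real set"
  assumes "k \<ge> 1"
    and "\<And>j. j \<in> {1..k} \<Longrightarrow> 0 < det (M j) \<and> det (M j) < 1/4 * (trace (M j))\<^sup>2"
    and "\<And>j. j \<in> {1..k} \<Longrightarrow> M j $ 1 $ 2 \<noteq> 0"
    and "J = stab_interval (M ` {1..k})"
    and "\<And>j. j \<in> {1..k} \<Longrightarrow> m_unstab (M j) \<notin> J"
  shows "invariant_cone (M ` {1..k}) (slope_cone J) \<and>
    ((\<forall>j\<in>{1..k}. \<forall>m\<in>J. H_poly (M j) m > 0) \<longrightarrow> expanding_cone (M ` {1..k}) (slope_cone J))"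
proof -
  have stab: "m_stab (M j) \<in> J" if "j \<in> {1..k}" for j
    using that unfolding assms(4) stab_interval_def by auto
  \<comment> \<open>Since \<open>k \<ge> 1\<close>, the index 1 is available and its stable slope
    witnesses that \<open>J\<close> is nonempty.\<close>
  have J: "is_interval J" "compact J" "J \<noteq> {}"
    using stab[of 1] assms(1) by (auto simp: assms(4) stab_interval_def is_interval_cc)
  note cone = double_cone_slope_cone[OF J(3)]
  have "M j *v v \<in> slope_cone J" if j: "j \<in> {1..k}" and v: "v \<in> slope_cone J" for j v
  proof (rule slope_cone_image[OF v])
    fix m assume m: "m \<in> J"
    have side: "(m - m_unstab (M j)) * (m_stab (M j) - m_unstab (M j)) > 0"
      using interval_same_side[OF J(1) stab[OF j] m assms(5)[OF j]] .
    note G = slope_map_in_closed_segment[OF _ _ assms(3)[OF j] side]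
    show "M j $ 1 $ 1 + M j $ 1 $ 2 * m \<noteq> 0"
      using G assms(2)[OF j] by blast
    \<comment> \<open>Both endpoints lie in the convex set \<open>J\<close>, so the segment holding
      the image slope does too.\<close>
    have "closed_segment (m_stab (M j)) m \<subseteq> J"
      using closed_segment_subset[OF stab[OF j] m] J(1) by (simp add: is_interval_convex)
    then show "slope_map (M j) m \<in> J"
      using G assms(2)[OF j] by blast
  qed
  then have "invariant_cone (M ` {1..k}) (slope_cone J)"
    using cone by (auto simp: invariant_cone_def)
  moreover have "expanding_cone (M ` {1..k}) (slope_cone J)"
    if "\<forall>j\<in>{1..k}. \<forall>m\<in>J. H_poly (M j) m > 0"
    unfolding expanding_cone_def
    using cone slope_cone_expansion[OF J(2,3)] that by blast
  ultimately show ?thesis by blast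
qed

end
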